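(* Let $k$ be a field, let $X=\{x_1,\dots,x_r\}$ be a nonempty finite set, fix a monomial order on $[X]$, and let $S\subseteq k[X]$ be a finite Gröbner basis for $k[X|S]=k[X]/\mathrm{Id}(S)$. Then $$\mathrm{GKdim}(k[X|S])=\mathrm{Sdeg}\big(\{u \mid u=x_1^{n_1}\cdots x_r^{n_r}\in \mathrm{Irr}(S),\ n_i\in\{0,\,C_S+1\},\ i\in\{1,\dots,r\}\}\big).$$
   Context: $\mathbb{N}$ is the set of nonnegative integers. $[X]$ is the free commutative monoid on $X$ with unit $\varepsilon$; $k[X]$ is the (unital) polynomial algebra with linear basis $[X]$. For $u=x_1^{n_1}\cdots x_r^{n_r}$, $\ell(u)=\sum n_i$. A monomial order on $[X]$ is a well order $<$ such that $u<v\Rightarrow wu<wv$ for all $u,v,w\in[X]$. For nonzero $f\in k[X]$, $\bar f$ is its leading (largest) monomial; $f$ is monic if the coefficient of $\bar f$ is $1$. A set $S\subseteq k[X]$ is monic if every element is nonzero and monic (the empty set is monic). $\mathrm{Id}(S)$ is the ideal generated by $S$. For an ideal $I$, a monic set $S$ is a Gröbner basis for $k[X]/I$ if $\mathrm{Id}(S)=I$ and for each nonzero $f\in I$ there are $s\in S$, $v\in[X]$ with $\bar f=\overline{sv}$. Set $\mathrm{Irr}(S)=[X]\setminus\{w\in [X]\mid w=\overline{sv}\text{ for some } s\in S, v\in[X]\}$. For a finite Gröbner basis $S$: $C_S=0$ if $S=\emptyset$; otherwise $C_S$ is the least $n\in\mathbb{N}$ such that $\bar s$ divides $x_1^n\cdots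 x_r^n$ for all $s\in S$. For $u=x_1^{n_1}\cdots x_r^{n_r}$, $\mathrm{Sdeg}(u)=\#\{i\mid n_i>C_S\}$. For nonempty $B\subseteq\mathrm{Irr}(S)$, $\mathrm{Sdeg}(B)=\max\{\mathrm{Sdeg}(\mu)\mid\mu\in B\}$; $\mathrm{Sdeg}(\emptyset)=0$. For an associative algebra $A$ over $k$, $\mathrm{GKdim}(A)=\sup_V\limsup_{n\to\infty}\log_n\dim(V^{\le n})$, the supremum over finite-dimensional subspaces $V$ of $A$, where $V^{n}$ is the span of all $n$-fold products of elements of $V$ and $V^{\le n}=V^1+\cdots+V^n$. The Gelfand-Kirillov dimension of the zero algebra is taken to be $0$. *)

theory Defs
  imports
    "HOL-Library.Poly_Mapping"
    "HOL-Library.Liminf_Limsup"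
    "HOL-Library.Extended_Real"
    "HOL-Algebra.QuotRing"
    "Jordan_Normal_Form.VS_Connect"
begin

section \<open>Monomials and polynomials\<close>

text \<open>
  The finite nonempty set of variables is a finite type \<open>'x\<close>.  A monomial is its exponent vector,
  so the product of monomials is written additively and the unit monomial is \<open>0\<close>.  Polynomials are
  finitely supported maps from monomials to coefficients, with the convolution product of
  \<^theory>\<open>HOL-Library.Poly_Mapping\<close>.
\<close>

type_synonym 'x monomial = "'x \<Rightarrow>\<^sub>0 nat"
type_synonym ('x, 'k) mpoly = "'x monomial \<Rightarrow>\<^sub>0 'k"

abbreviation mono_poly :: "'x monomial \<Rightarrow> ('x, 'k::field) mpoly" where
  "mono_poly v \<equiv> Poly_Mapping.single v 1"

abbreviation const_poly :: "'k::field \<Rightarrow> ('x, 'k) mpoly" where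
  "const_poly c \<equiv> Poly_Mapping.single 0 c"

definition mono_divides :: "'x monomial \<Rightarrow> 'x monomial \<Rightarrow> bool" where
  "mono_divides u v \<longleftrightarrow> (\<exists>w. v = u + w)"

text \<open>\<open>(u, v) \<in> r\<close> stands for \<open>u \<le> v\<close>; the strict order is \<open>r - Id\<close>.\<close>

definition monomial_order :: "'x monomial rel \<Rightarrow> bool" where
  "monomial_order r \<longleftrightarrow>
     well_order r \<and> (\<forall>u v w. (u, v) \<in> r - Id \<longrightarrow> (w + u, w + v) \<in> r - Id)"

definition lead_mono :: "'x monomial rel \<Rightarrow> ('x, 'k::field) mpoly \<Rightarrow> 'x monomial" where
  "lead_mono r f = (THE u. u \<in> Poly_Mapping.keys f \<and> (\<forall>v \<in> Poly_Mapping.keys f. (v, u) \<in> r))"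

definition monic_set :: "'x monomial rel \<Rightarrow> ('x, 'k::field) mpoly set \<Rightarrow> bool" where
  "monic_set r S \<longleftrightarrow> (\<forall>f \<in> S. f \<noteq> 0 \<and> Poly_Mapping.lookup f (lead_mono r f) = 1)"


section \<open>Groebner bases\<close>

abbreviation Id_gen :: "('x, 'k::field) mpoly set \<Rightarrow> ('x, 'k) mpoly set" where
  "Id_gen S \<equiv> Idl\<^bsub>class_ring\<^esub> S"

definition groebner_basis ::
  "'x monomial rel \<Rightarrow> ('x, 'k::field) mpoly set \<Rightarrow> ('x, 'k) mpoly set \<Rightarrow> bool" where
  "groebner_basis r I S \<longleftrightarrow>
     ideal I class_ring \<and> monic_set r S \<and> Id_gen S = I \<and>
     (\<forall>f \<in> I. f \<noteq> 0 \<longrightarrow> (\<exists>s \<in> S. \<exists>v. lead_mono r f = lead_mono r (s * mono_poly v)))"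

definition Irr :: "'x monomial rel \<Rightarrow> ('x, 'k::field) mpoly set \<Rightarrow> 'x monomial set" where
  "Irr r S = UNIV - {w. \<exists>s \<in> S. \<exists>v. w = lead_mono r (s * mono_poly v)}"


section \<open>The degree \<open>Sdeg\<close>\<close>

text \<open>The sum below is the exponent vector of \<open>x\<^sub>1\<^sup>n \<cdots> x\<^sub>r\<^sup>n\<close>.\<close>

definition C_bound :: "'x::finite monomial rel \<Rightarrow> ('x, 'k::field) mpoly set \<Rightarrow> nat" where
  "C_bound r S =
     (if S = {} then 0
      else LEAST n. \<forall>s \<in> S. mono_divides (lead_mono r s) (\<Sum>x \<in> UNIV. Poly_Mapping.single x n))"

definition Sdeg_mono ::
  "'x::finite monomial rel \<Rightarrow> ('x, 'k::field) mpoly set \<Rightarrow> 'x monomial \<Rightarrow> nat" where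
  "Sdeg_mono r S u = card {x. Poly_Mapping.lookup u x > C_bound r S}"

text \<open>
  The set of values \<open>Sdeg_mono r S ` B\<close> is finite even for infinite \<open>B\<close>, being bounded by the
  number of variables.
\<close>

definition Sdeg ::
  "'x::finite monomial rel \<Rightarrow> ('x, 'k::field) mpoly set \<Rightarrow> 'x monomial set \<Rightarrow> nat" where
  "Sdeg r S B = (if B = {} then 0 else Max (Sdeg_mono r S ` B))"


section \<open>Gelfand-Kirillov dimension\<close>

text \<open>
  An algebra \<open>A\<close> over \<open>K\<close> is a module record over \<open>K\<close> together with the ring structure that every
  module record carries.  Subspaces are given by their carrier \<open>V\<close>.
\<close>

definition nfold_products :: "('a, 'b, 'c) module_scheme \<Rightarrow> 'b set \<Rightarrow> nat \<Rightarrow> 'b set" where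
  "nfold_products A V n = {foldr (\<otimes>\<^bsub>A\<^esub>) vs \<one>\<^bsub>A\<^esub> | vs. length vs = n \<and> set vs \<subseteq> V}"

definition subspace_pow ::
  "('a, 'd) ring_scheme \<Rightarrow> ('a, 'b, 'c) module_scheme \<Rightarrow> 'b set \<Rightarrow> nat \<Rightarrow> 'b set" where
  "subspace_pow K A V n = LinearCombinations.module.span K A (nfold_products A V n)"

text \<open>\<open>subspace_pow_upto K A V n\<close> is \<open>V\<^sup>1 + \<cdots> + V\<^sup>n\<close>; the sum starts at exponent \<open>1\<close>, so it need not
  contain the unit of \<open>A\<close>.\<close>

primrec subspace_pow_upto ::
  "('a, 'd) ring_scheme \<Rightarrow> ('a, 'b, 'c) module_scheme \<Rightarrow> 'b set \<Rightarrow> nat \<Rightarrow> 'b set" where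
  "subspace_pow_upto K A V 0 = {\<zero>\<^bsub>A\<^esub>}"
| "subspace_pow_upto K A V (Suc n) =
     subspace_pow_upto K A V n <+>\<^bsub>A\<^esub> subspace_pow K A V (Suc n)"

text \<open>
  The value \<open>0\<close> for the zero algebra is a convention.  In a nonzero algebra the subspace \<open>V = 0\<close>
  contributes \<open>0\<close> to the supremum, because \<open>log n 0 = 0\<close> in HOL, instead of minus infinity.  This
  does not change the supremum: every \<open>V\<close> containing the unit contributes a nonnegative value.
\<close>

definition gk_dim :: "('a, 'd) ring_scheme \<Rightarrow> ('a, 'b, 'c) module_scheme \<Rightarrow> ereal" where
  "gk_dim K A =
     (if carrier A = {\<zero>\<^bsub>A\<^esub>} then 0
      else SUP V \<in> {V. VectorSpace.subspace K V A \<and> vectorspace.fin_dim K (A\<lparr>carrier := V\<rparr>)}.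
             limsup (\<lambda>n. ereal (log (real n)
               (real (vectorspace.dim K (A\<lparr>carrier := subspace_pow_upto K A V n\<rparr>))))))"


section \<open>The quotient algebra\<close>

text \<open>
  The library quotient ring of the polynomial ring by \<open>I\<close>, with the scalar \<open>c\<close> acting as
  multiplication by the coset of the constant polynomial \<open>c\<close>.
\<close>

definition quot_algebra ::
  "('x, 'k::field) mpoly set \<Rightarrow> ('k, ('x, 'k) mpoly set) module" where
  "quot_algebra I =
     ring.extend (class_ring Quot I)
       \<lparr>smult = (\<lambda>c F. (I +>\<^bsub>class_ring\<^esub> const_poly c) \<otimes>\<^bsub>class_ring Quot I\<^esub> F)\<rparr>"

lemma quot_algebra_algebra:
  fixes I :: "('x, 'k::field) mpoly set"
  assumes "ideal I class_ring"
  shows "algebra (class_ring :: 'k ring) (quot_algebra I)"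
proof -
  let ?P = "class_ring :: ('x, 'k) mpoly ring"
  let ?Q = "?P Quot I" and ?h = "\<lambda>f. I +>\<^bsub>?P\<^esub> f"
  have P: "cring ?P"
    by (unfold_locales) (auto simp: field_simps)
  interpret I: ideal I ?P by (rule assms)
  interpret Q: cring ?Q by (rule I.quotient_is_cring[OF P])
  have h: "?h \<in> Ring.ring_hom ?P ?Q" by (rule I.rcos_ring_hom)
  have h_closed: "?h f \<in> carrier ?Q" for f
    using ring_hom_closed[OF h] by simp
  have h_add: "?h (f + g) = ?h f \<oplus>\<^bsub>?Q\<^esub> ?h g" and h_mult: "?h (f * g) = ?h f \<otimes>\<^bsub>?Q\<^esub> ?h g" for f g
    using ring_hom_add[OF h, of f g] ring_hom_mult[OF h, of f g] by simp_all
  have h_one: "?h 1 = \<one>\<^bsub>?Q\<^esub>"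
    using ring_hom_one[OF h] by simp
  have sel: "carrier (quot_algebra I) = carrier ?Q" "mult (quot_algebra I) = mult ?Q"
    "one (quot_algebra I) = one ?Q" "zero (quot_algebra I) = zero ?Q"
    "add (quot_algebra I) = add ?Q"
    "smult (quot_algebra I) = (\<lambda>c F. ?h (const_poly c) \<otimes>\<^bsub>?Q\<^esub> F)"
    by (simp_all add: quot_algebra_def ring.extend_def)
  have Q': "cring (quot_algebra I)"
  proof (rule cringI)
    show "abelian_group (quot_algebra I)"
    proof (rule abelian_groupI)
      fix x assume "x \<in> carrier (quot_algebra I)"
      then show "\<exists>y\<in>carrier (quot_algebra I). y \<oplus>\<^bsub>quot_algebra I\<^esub> x = \<zero>\<^bsub>quot_algebra I\<^esub>"
        using Q.l_neg Q.a_inv_closed unfolding sel by blast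
    qed (simp_all add: sel Q.a_ac)
    show "comm_monoid (quot_algebra I)"
      by (rule comm_monoidI) (simp_all add: sel Q.m_ac)
  qed (simp add: sel Q.l_distr)
  have "cring (class_ring :: 'k ring)"
    by (unfold_locales) (auto simp: field_simps)
  then show ?thesis
  proof (rule algebraI[OF _ Q'])
  qed (simp_all add: sel h_closed single_add h_add Q.l_distr Q.r_distr Q.m_assoc
        mult_single[of 0 _ 0, simplified, symmetric] h_mult single_one h_one)
qed

end

theory Submission
  imports Defs
begin

text \<open>
  The monomials of \<open>Irr(S)\<close> form a basis of the quotient algebra, so dimensions are counts of
  irreducible monomials.  As no leading monomial has an exponent above \<open>C\<^sub>S\<close>, whether a monomial is
  irreducible depends only on its exponents truncated at \<open>C\<^sub>S + 1\<close>.  Hence the irreducible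
  monomials with all exponents at most \<open>N\<close> are confined to finitely many boxes with at most \<open>d\<close> long
  sides, \<open>d\<close> being the claimed dimension, and they contain a box with exactly \<open>d\<close> long sides: their
  number grows like \<open>N\<^sup>d\<close>.

  The monomial order need not be compatible with the degree, so reduction modulo \<open>S\<close> may raise the
  degree.  But \<open>S\<close> is finite, and finitely many strict inequalities of a monomial order are also
  satisfied by a positive linear weight on the exponents.  Reduction does not raise this weight, and
  the weight and the degree bound each other up to constants.
\<close>

section \<open>Dimension, positive functionals, exponent vectors\<close>

text \<open>An independent subset of \<open>W\<close> stays independent in \<open>V\<close>, so the
  exchange lemma bounds its size by \<open>card B\<close>. A maximal one is therefore finite and is
  a basis of \<open>W\<close>, which settles both finite-dimensionality and the bound.\<close>

lemma (in vectorspace) subspace_dim_le_card: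
  assumes W: "subspace K W V" and B: "finite B" "B \<subseteq> carrier V" and sub: "W \<subseteq> span B"
  shows "vectorspace.fin_dim K (vs W)" and "vectorspace.dim K (vs W) \<le> card B"
proof -
  interpret W: vectorspace K "vs W" by (rule subspace_is_vs[OF W])
  have WV: "W \<subseteq> carrier V"
    using W by (auto simp: VectorSpace.subspace_def submodule_def)
  have card_le: "card A \<le> card B" if A: "finite A" "A \<subseteq> W" "W.lin_indpt A" for A
  proof -
    have "lin_indpt A"
      using span_li_not_depend(2)[OF A(2) is_module[OF W]] A(3) by simp
    then obtain C :: "'c set" where "int (card C) \<le> int (card B) - int (card A)"
      using replacement[OF A(1) B _ order.trans[OF A(2) sub]] by blast
    then show ?thesis by linarith
  qed
  have bound: "finite A \<and> card A \<le> card B" if A: "A \<subseteq> carrier (vs W) \<and> W.lin_indpt A" for A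
  proof -
    have "finite A"
    proof (rule ccontr)
      assume "infinite A"
      \<comment> \<open>One element more than \<open>card B\<close> already contradicts
        \<open>card_le\<close>, which speaks of finite sets only.\<close>
      then obtain A' where A': "A' \<subseteq> A" "finite A'" "card A' = Suc (card B)"
        by (meson infinite_arbitrarily_large)
      have "A' \<subseteq> W" using A' A by auto
      moreover have "W.lin_indpt A'" using W.subset_li_is_li[of A A'] A A'(1) by blast
      ultimately have "card A' \<le> card B" by (rule card_le[OF A'(2)])
      then show False using A' by simp
    qed
    then show ?thesis using card_le A by simp
  qed
  have "W.lin_indpt {}"
    by (auto simp: W.lin_dep_def)
  then obtain A where A: "finite A" "maximal A (\<lambda>S. S \<subseteq> carrier (vs W) \<and> W.lin_indpt S)"
    using maximal_exists[of "\<lambda>S. S \<subseteq> carrier (vs W) \<and> W.lin_indpt S", OF bound, of "{}"] by auto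
  have basis: "W.basis A" by (rule W.max_li_is_basis[OF A(2)])
  then show "W.fin_dim" using A(1) unfolding W.fin_dim_def W.basis_def by blast
  show "W.dim \<le> card B"
    using W.dim_basis[OF A(1) basis] bound basis unfolding W.basis_def by simp
qed

lemma (in vectorspace) card_le_subspace_dim:
  assumes W: "subspace K W V" "vectorspace.fin_dim K (vs W)" and A: "A \<subseteq> W" "lin_indpt A"
  shows "card A \<le> vectorspace.dim K (vs W)"
proof -
  interpret W: vectorspace K "vs W" by (rule subspace_is_vs[OF W(1)])
  show ?thesis
    using W.li_le_dim(2)[OF W(2)] span_li_not_depend(2)[OF A(1) is_module[OF W(1)]] A by simp
qed

section \<open>Positive linear functionals on integer vectors\<close>

lemma finite_sets_separated:
  fixes A B :: "real set"
  assumes "finite A" "finite B" and less: "\<And>a b. a \<in> A \<Longrightarrow> b \<in> B \<Longrightarrow> a < b"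
  shows "\<exists>t. (\<forall>a\<in>A. a < t) \<and> (\<forall>b\<in>B. t < b)"
proof (cases "B = {}")
  case True
  have "a < Max (insert 0 A) + 1" if "a \<in> A" for a
    by (rule le_less_trans[OF Max_ge[of "insert 0 A" a]]) (use \<open>finite A\<close> that in auto)
  then show ?thesis using True by blast
next
  case False
  define m where "m = Min B"
  have m: "m \<in> B" "\<And>b. b \<in> B \<Longrightarrow> m \<le> b"
    using False \<open>finite B\<close> by (simp_all add: m_def)
  \<comment> \<open>Inserting \<open>m - 1\<close> keeps the maximum defined for empty
    \<open>A\<close> without reaching \<open>m\<close>.\<close>
  define M where "M = Max (insert (m - 1) A)"
  have M: "M \<in> insert (m - 1) A" unfolding M_def using \<open>finite A\<close> by (intro Max_in) auto
  have M_ge: "a \<le> M" if "a \<in> A" for a unfolding M_def using \<open>finite A\<close> that by (intro Max_ge) auto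
  have "M < m" using M less m(1) by auto
  then obtain t where "M < t" "t < m" using dense by blast
  then show ?thesis using M_ge m(2) by (meson order.strict_trans1 order.strict_trans2)
qed

text \<open>
  Gordan's alternative, by Fourier--Motzkin elimination.  The set \<open>P\<close> replaces the usual condition that
  no nontrivial nonnegative combination of \<open>D\<close> vanishes.
\<close>

lemma positive_functional_exists:
  fixes P :: "('x \<Rightarrow> int) set"
  assumes "finite A" and "finite D" and "D \<subseteq> P"
    and zero: "(\<lambda>_. 0) \<notin> P"
    and add: "\<And>f g. f \<in> P \<Longrightarrow> g \<in> P \<Longrightarrow> (\<lambda>x. f x + g x) \<in> P"
    and "\<forall>d\<in>D. \<forall>x. x \<notin> A \<longrightarrow> d x = 0"
  shows "\<exists>w :: 'x \<Rightarrow> real. \<forall>d\<in>D. 0 < (\<Sum>x\<in>A. w x * of_int (d x))"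
  using assms(1,2,3,6)
proof (induction A arbitrary: D rule: finite_induct)
  case empty
  \<comment> \<open>With no coordinate left, an element of \<open>D\<close> would be the zero
    function, which \<open>P\<close> omits.\<close>
  then have "D = {}" using zero by (metis all_not_in_conv empty_iff ext subsetD)
  then show ?case by simp
next
  case (insert a A)
  \<comment> \<open>Closure of \<open>P\<close> under addition yields closure under positive integer
    multiples; this is what the integrality of the values is for.\<close>
  define scale where "scale n d = (\<lambda>x. n * d x)" for n :: int and d :: "'x \<Rightarrow> int"
  have scale: "scale n d \<in> P" if "d \<in> P" "0 < n" for n d
    using that(2)
  proof (induction n rule: int_gr_induct)
    case base
    then show ?case using that(1) by (simp add: scale_def)
  next
    case (step i)
    have "scale (i + 1) d = (\<lambda>x. scale i d x + d x)"
      by (auto simp: scale_def fun_eq_iff algebra_simps)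
    then show ?case using add[OF step.IH that(1)] by simp
  qed
  \<comment> \<open>One elimination step: for \<open>e a > 0 > d a\<close> the multipliers
    \<open>e a\<close> and \<open>- d a\<close> are positive and cancel the coordinate
    \<open>a\<close>, so the combination stays in \<open>P\<close>.\<close>
  define comb where "comb e d = (\<lambda>x. scale (e a) d x + scale (- d a) e x)" for e d
  define E where "E = {d \<in> D. d a = 0} \<union>
     (\<lambda>(e, d). comb e d) ` ({e \<in> D. 0 < e a} \<times> {d \<in> D. d a < 0})"
  have E: "finite E" using insert.prems by (auto simp: E_def)
  have EP: "E \<subseteq> P"
  proof -
    have "comb e d \<in> P" if "e \<in> D" "0 < e a" "d \<in> D" "d a < 0" for e d
      unfolding comb_def using that insert.prems(2) by (intro add scale) auto
    then show ?thesis using insert.prems(2) by (auto simp: E_def)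
  qed
  have E0: "d x = 0" if dE: "d \<in> E" and "x \<notin> A" for d x
  proof -
    have "f x = 0" if "f \<in> D" "x \<noteq> a" for f
      using insert.prems(3) that(1) \<open>x \<notin> A\<close> that(2) by simp
    moreover have "comb e f a = 0" for e f
      by (simp add: comb_def scale_def)
    moreover have "comb e f x = 0" if "e x = 0" "f x = 0" for e f
      using that by (simp add: comb_def scale_def)
    moreover have "d \<in> D \<and> d a = 0 \<or> (\<exists>e\<in>D. \<exists>f\<in>D. d = comb e f)"
      using dE by (auto simp: E_def)
    ultimately show ?thesis by metis
  qed
  obtain w where w: "\<forall>d\<in>E. 0 < (\<Sum>x\<in>A. w x * real_of_int (d x))"
    using insert.IH[OF E EP] E0 by auto
  define L where "L d = (\<Sum>x\<in>A. w x * of_int (d x))" for d :: "'x \<Rightarrow> int"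
  \<comment> \<open>Bounds on the coefficient \<open>t\<close> to be chosen at \<open>a\<close>:
    positivity on \<open>e\<close> with \<open>e a > 0\<close> asks for \<open>t\<close> above an
    element of \<open>lo\<close>, positivity on \<open>d\<close> with \<open>d a < 0\<close> for
    \<open>t\<close> below an element of \<open>hi\<close>.\<close>
  define lo where "lo = (\<lambda>e. - L e / of_int (e a)) ` {e \<in> D. 0 < e a}"
  define hi where "hi = (\<lambda>d. - L d / of_int (d a)) ` {d \<in> D. d a < 0}"
  have fin: "finite lo" "finite hi" using insert.prems(1) by (auto simp: lo_def hi_def)
  \<comment> \<open>The gap \<open>q - p\<close> is a positive multiple of
    \<open>L (comb e d)\<close>, which is positive because \<open>comb e d\<close> lies in
    \<open>E\<close>.\<close>
  have lt: "p < q" if pq: "p \<in> lo" "q \<in> hi" for p q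
  proof -
    obtain e d :: "'x \<Rightarrow> int" where ed: "e \<in> D" "0 < e a" "p = - L e / of_int (e a)"
       "d \<in> D" "d a < 0" "q = - L d / of_int (d a)"
      using pq unfolding lo_def hi_def by blast
    have "comb e d \<in> E" using ed by (auto simp: E_def)
    then have "0 < L (comb e d)" using w by (simp add: L_def)
    also have "L (comb e d) = of_int (e a) * L d - of_int (d a) * L e"
      by (simp add: L_def comb_def scale_def sum.distrib sum_distrib_left algebra_simps sum_subtractf)
    also have "\<dots> = (of_int (e a) * of_int (- d a)) * (q - p)"
      using ed by (simp add: algebra_simps)
    finally have "0 < (of_int (e a) * of_int (- d a)) * (q - p)" .
    moreover have "0 < (of_int (e a) * of_int (- d a) :: real)"
      using ed by (intro mult_pos_pos) simp_all
    ultimately have "0 < q - p" by (rule zero_less_mult_pos)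
    then show ?thesis by simp
  qed
  obtain t where t: "\<forall>p\<in>lo. p < t" "\<forall>q\<in>hi. t < q"
    using finite_sets_separated[OF fin lt] by blast
  have "0 < L d + t * of_int (d a)" if "d \<in> D" for d
  proof -
    consider "d a = 0" | "0 < d a" | "d a < 0" by linarith
    then show ?thesis
    proof cases
      case 1
      then show ?thesis using w that by (auto simp: E_def L_def)
    next
      case 2
      then have "- L d / of_int (d a) < t" using t(1) that by (auto simp: lo_def)
      then show ?thesis using 2 by (simp add: field_simps)
    next
      case 3
      then have "t < - L d / of_int (d a)" using t(2) that by (auto simp: hi_def)
      then show ?thesis using 3 by (simp add: field_simps)
    qed
  qed
  moreover have "(\<Sum>x\<in>insert a A. (w(a := t)) x * of_int (d x)) = L d + t * of_int (d a)" for d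
  proof -
    have "(\<Sum>x\<in>A. (w(a := t)) x * of_int (d x)) = L d"
      unfolding L_def by (rule sum.cong) (use insert.hyps in auto)
    then show ?thesis using insert.hyps by simp
  qed
  ultimately show ?case by (intro exI[of _ "w(a := t)"]) simp
qed

text \<open>For \<open>n > 1\<close> the logarithm equals \<open>ln c / ln n + d\<close>, so the
  constant factor vanishes in the limit. Bounds by constant multiples of \<open>n ^ d\<close>
  thereby become bounds on the limsup.\<close>

lemma tendsto_log_const_mult_power:
  fixes c :: real
  assumes "0 < c"
  shows "(\<lambda>n. log (real n) (c * real n ^ d)) \<longlonglongrightarrow> real d"
proof -
  have "filterlim (\<lambda>n. ln (real n)) at_infinity sequentially"
    by (intro filterlim_at_top_imp_at_infinity filterlim_compose[OF ln_at_top] filterlim_real_sequentially)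
  then have "(\<lambda>n. ln c / ln (real n) + real d) \<longlonglongrightarrow> 0 + real d"
    by (intro tendsto_add tendsto_const tendsto_divide_0[OF tendsto_const])
  moreover have "\<forall>\<^sub>F n in sequentially. ln c / ln (real n) + real d = log (real n) (c * real n ^ d)"
    using eventually_gt_at_top[of 1]
  proof eventually_elim
    case (elim n)
    then have "ln (real n) > 0" by simp
    then show ?case using elim assms
      by (simp add: log_def ln_mult ln_realpow field_simps)
  qed
  ultimately show ?thesis by (simp add: Lim_transform_eventually)
qed

section \<open>Exponent vectors and the terms of a polynomial\<close>

lemma card_poly_mapping_box:
  fixes B :: "'x::finite \<Rightarrow> nat set"
  assumes "\<And>x. finite (B x)"
  shows "finite {m :: 'x \<Rightarrow>\<^sub>0 nat. \<forall>x. Poly_Mapping.lookup m x \<in> B x}"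
    and "card {m :: 'x \<Rightarrow>\<^sub>0 nat. \<forall>x. Poly_Mapping.lookup m x \<in> B x} = (\<Prod>x\<in>UNIV. card (B x))"
proof -
  have "bij_betw Poly_Mapping.lookup {m :: 'x \<Rightarrow>\<^sub>0 nat. \<forall>x. Poly_Mapping.lookup m x \<in> B x} (PiE UNIV B)"
  proof (rule bij_betw_byWitness[where f' = Abs_poly_mapping])
    show "Abs_poly_mapping ` PiE UNIV B \<subseteq> {m. \<forall>x. Poly_Mapping.lookup m x \<in> B x}"
      by (auto simp: Abs_poly_mapping_inverse PiE_iff)
  qed (auto simp: Poly_Mapping.lookup_inverse Abs_poly_mapping_inverse)
  then show "finite {m :: 'x \<Rightarrow>\<^sub>0 nat. \<forall>x. Poly_Mapping.lookup m x \<in> B x}"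
    and "card {m :: 'x \<Rightarrow>\<^sub>0 nat. \<forall>x. Poly_Mapping.lookup m x \<in> B x} = (\<Prod>x\<in>UNIV. card (B x))"
    using assms by (auto dest: bij_betw_finite bij_betw_same_card simp: finite_PiE card_PiE)
qed

lemma poly_mapping_sum_singles:
  "(\<Sum>k\<in>Poly_Mapping.keys f. Poly_Mapping.single k (Poly_Mapping.lookup f k)) = f"
  by (rule poly_mapping_eqI) (simp add: lookup_sum lookup_single when_def in_keys_iff)

text \<open>Any \<open>f\<close> is the finite sum of its terms. Only terms that occur in
  \<open>f\<close> are asked to satisfy \<open>P\<close>, so \<open>P\<close> may fail for other
  monomials.\<close>

lemma poly_mapping_closure:
  fixes f :: "'a \<Rightarrow>\<^sub>0 'b::comm_monoid_add"
  assumes "P 0" and "\<And>f g. P f \<Longrightarrow> P g \<Longrightarrow> P (f + g)"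
    and "\<And>k. k \<in> Poly_Mapping.keys f \<Longrightarrow> P (Poly_Mapping.single k (Poly_Mapping.lookup f k))"
  shows "P f"
proof -
  have "P (\<Sum>k\<in>K. Poly_Mapping.single k (Poly_Mapping.lookup f k))" if "K \<subseteq> Poly_Mapping.keys f" for K
    using finite_subset[OF that finite_keys] that
    by (induction K rule: finite_induct) (use assms in auto)
  from this[OF subset_refl] show ?thesis by (simp only: poly_mapping_sum_singles)
qed

text \<open>Shifting exponents by \<open>v\<close> is injective by cancellation, so multiplication
  by a monomial never merges two terms.\<close>

lemma lookup_times_single:
  fixes f :: "('a::cancel_comm_monoid_add) \<Rightarrow>\<^sub>0 ('b::semiring_1)"
  shows "Poly_Mapping.lookup (f * Poly_Mapping.single v 1) (u + v) = Poly_Mapping.lookup f u"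
proof -
  have "f * Poly_Mapping.single v 1 =
      (\<Sum>k\<in>Poly_Mapping.keys f. Poly_Mapping.single k (Poly_Mapping.lookup f k)) * Poly_Mapping.single v 1"
    by (simp only: poly_mapping_sum_singles)
  also have "\<dots> = (\<Sum>k\<in>Poly_Mapping.keys f. Poly_Mapping.single (k + v) (Poly_Mapping.lookup f k))"
    by (simp add: sum_distrib_right mult_single)
  finally have "Poly_Mapping.lookup (f * Poly_Mapping.single v 1) (u + v) =
      (\<Sum>k\<in>Poly_Mapping.keys f. Poly_Mapping.lookup f k when k = u)"
    by (simp only: lookup_sum lookup_single add_right_cancel)
  also have "\<dots> = Poly_Mapping.lookup f u"
    by (simp add: when_def in_keys_iff)
  finally show ?thesis .
qed

lemma keys_times_single:
  fixes f :: "('a::cancel_comm_monoid_add) \<Rightarrow>\<^sub>0 ('b::semiring_1)"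
  shows "Poly_Mapping.keys (f * Poly_Mapping.single v 1) = (\<lambda>u. u + v) ` Poly_Mapping.keys f"
proof
  show "Poly_Mapping.keys (f * Poly_Mapping.single v 1) \<subseteq> (\<lambda>u. u + v) ` Poly_Mapping.keys f"
    using keys_mult[of f "Poly_Mapping.single v 1"] by (auto split: if_splits)
  show "(\<lambda>u. u + v) ` Poly_Mapping.keys f \<subseteq> Poly_Mapping.keys (f * Poly_Mapping.single v 1)"
    by (auto simp: in_keys_iff lookup_times_single)
qed

text \<open>Subtraction of exponents truncates at 0; under this hypothesis nothing is truncated, and
  \<open>v - u\<close> is the cofactor witnessing that \<open>u\<close> divides
  \<open>v\<close>.\<close>

lemma nat_poly_mapping_le_add_diff:
  fixes u v :: "'x \<Rightarrow>\<^sub>0 nat"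
  assumes "\<And>x. Poly_Mapping.lookup u x \<le> Poly_Mapping.lookup v x"
  shows "u + (v - u) = v"
  using assms by (intro poly_mapping_eqI) (simp add: lookup_add lookup_minus)

lemma lookup_sum_single:
  fixes D :: "'x::finite set"
  shows "Poly_Mapping.lookup (\<Sum>x\<in>D. Poly_Mapping.single x n) y = (if y \<in> D then n else (0::nat))"
  by (simp add: lookup_sum lookup_single when_def)

section \<open>Irreducible monomials and the quotient algebra\<close>

lemma linear_order_finite_max:
  assumes "linear_order r" "finite A" "A \<noteq> {}"
  shows "\<exists>u\<in>A. \<forall>v\<in>A. (v, u) \<in> r"
  using assms(2,3)
proof (induction A rule: finite_ne_induct)
  case (singleton a)
  then show ?case using assms(1) by (auto simp: order_on_defs refl_on_def)
next
  case (insert a A)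
  then obtain u where u: "u \<in> A" "\<forall>v\<in>A. (v, u) \<in> r" by blast
  have refl: "(a, a) \<in> r" and total: "(a, u) \<in> r \<or> (u, a) \<in> r" and trans: "trans r"
    using assms(1) by (auto simp: order_on_defs refl_on_def total_on_def) metis
  from total show ?case
  proof
    assume "(u, a) \<in> r"
    then show ?thesis using refl u transD[OF trans] by blast
  qed (use u in blast)
qed

locale groebner =
  fixes r :: "('x::finite) monomial rel" and S :: "('x, 'k::field) mpoly set"
  assumes order: "monomial_order r"
    and finite_basis: "finite S"
    and basis: "groebner_basis r (Id_gen S) S"
begin

abbreviation mono_less (infix "\<prec>" 50) where "u \<prec> v \<equiv> (u, v) \<in> r - Id"

lemma linear_order: "linear_order r"
  using order by (simp add: monomial_order_def well_order_on_def)

lemma mono_less_trans: "u \<prec> v \<Longrightarrow> v \<prec> w \<Longrightarrow> u \<prec> w"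
  using linear_order by (auto simp: order_on_defs dest: transD antisymD)

lemma mono_less_add: "u \<prec> v \<Longrightarrow> w + u \<prec> w + v"
  using order by (simp add: monomial_order_def)

lemma mono_less_linear: "u \<noteq> v \<Longrightarrow> u \<prec> v \<or> v \<prec> u"
  using linear_order by (auto simp: order_on_defs total_on_def)

lemma wf_mono_less: "wf (r - Id)"
  using order by (simp add: monomial_order_def well_order_on_def)

text \<open>If something lay below the unit monomial, a minimal such \<open>z\<close> would satisfy
  \<open>z + z \<prec> z\<close>, against minimality.\<close>

lemma zero_mono_less:
  assumes "u \<noteq> 0"
  shows "0 \<prec> u"
proof (rule ccontr)
  assume "\<not> 0 \<prec> u"
  then have "u \<in> {z. z \<prec> 0}" using mono_less_linear[OF assms] by blast
  then obtain z where z: "z \<prec> 0" and min: "\<And>y. y \<prec> z \<Longrightarrow> y \<notin> {z. z \<prec> 0}"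
    using wfE_min[OF wf_mono_less] by (metis mem_Collect_eq)
  have "z + z \<prec> z" using mono_less_add[OF z, of z] by simp
  then show False using min mono_less_trans z by blast
qed

lemma lead_mono_eqI:
  assumes "u \<in> Poly_Mapping.keys f" "\<And>v. v \<in> Poly_Mapping.keys f \<Longrightarrow> v = u \<or> v \<prec> u"
  shows "lead_mono r f = u"
  unfolding lead_mono_def
proof (rule the_equality)
  have "(v, u) \<in> r" if "v \<in> Poly_Mapping.keys f" for v
    using assms(2)[OF that] linear_order by (auto simp: order_on_defs refl_on_def)
  then show 1: "u \<in> Poly_Mapping.keys f \<and> (\<forall>v\<in>Poly_Mapping.keys f. (v, u) \<in> r)"
    using assms(1) by blast
  show "u' = u" if "u' \<in> Poly_Mapping.keys f \<and> (\<forall>v\<in>Poly_Mapping.keys f. (v, u') \<in> r)" for u'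
    using that 1 linear_order by (auto simp: order_on_defs dest: antisymD)
qed

lemma lead_mono:
  assumes "f \<noteq> 0"
  shows "lead_mono r f \<in> Poly_Mapping.keys f"
    and "v \<in> Poly_Mapping.keys f \<Longrightarrow> v \<noteq> lead_mono r f \<Longrightarrow> v \<prec> lead_mono r f"
proof -
  have "Poly_Mapping.keys f \<noteq> {}"
    using assms by (auto intro!: poly_mapping_eqI simp: in_keys_iff)
  then obtain u where u: "u \<in> Poly_Mapping.keys f" "\<And>v. v \<in> Poly_Mapping.keys f \<Longrightarrow> (v, u) \<in> r"
    using linear_order_finite_max[OF linear_order finite_keys] by metis
  then have "lead_mono r f = u" by (intro lead_mono_eqI) auto
  then show "lead_mono r f \<in> Poly_Mapping.keys f"
    and "v \<in> Poly_Mapping.keys f \<Longrightarrow> v \<noteq> lead_mono r f \<Longrightarrow> v \<prec> lead_mono r f"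
    using u by auto
qed

lemma lead_mono_times_mono:
  fixes f :: "('x, 'k) mpoly"
  assumes "f \<noteq> 0"
  shows "lead_mono r (f * mono_poly v) = lead_mono r f + v"
proof (rule lead_mono_eqI)
  show "lead_mono r f + v \<in> Poly_Mapping.keys (f * mono_poly v)"
    using lead_mono(1)[OF assms] by (simp add: keys_times_single)
  fix u assume "u \<in> Poly_Mapping.keys (f * mono_poly v)"
  then obtain u' where "u = u' + v" "u' \<in> Poly_Mapping.keys f"
    by (auto simp: keys_times_single)
  then show "u = lead_mono r f + v \<or> u \<prec> lead_mono r f + v"
    using lead_mono(2)[OF assms, of u'] mono_less_add[of u' "lead_mono r f" v]
    by (metis add.commute)
qed

lemma basis_nonzero: "s \<in> S \<Longrightarrow> s \<noteq> 0"
  and basis_monic: "s \<in> S \<Longrightarrow> Poly_Mapping.lookup s (lead_mono r s) = 1"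
  using basis by (auto simp: groebner_basis_def monic_set_def)

lemma Irr_iff: "u \<in> Irr r S \<longleftrightarrow> (\<forall>s\<in>S. \<forall>v. u \<noteq> lead_mono r s + v)"
  by (auto simp: Irr_def lead_mono_times_mono basis_nonzero)

lemma Irr_downward:
  assumes "u + v \<in> Irr r S"
  shows "u \<in> Irr r S"
  using assms unfolding Irr_iff by (metis add.assoc)

text \<open>By the Groebner property the leading monomial of a nonzero ideal element is reducible,
  yet it is one of its keys. Independence of the irreducible monomials modulo the ideal rests on
  this.\<close>

lemma ideal_Irr_eq_0:
  assumes "f \<in> Id_gen S" "Poly_Mapping.keys f \<subseteq> Irr r S"
  shows "f = 0"
proof (rule ccontr)
  assume f: "f \<noteq> 0"
  then obtain s v where "s \<in> S" "lead_mono r f = lead_mono r (s * mono_poly v)"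
    using basis assms(1) by (auto simp: groebner_basis_def)
  then have "lead_mono r f \<notin> Irr r S"
    by (auto simp: Irr_def)
  then show False using lead_mono(1)[OF f] assms(2) by blast
qed

text \<open>The exponent differences \<open>v - u\<close> with \<open>u \<prec> v\<close> form a set
  closed under addition and without 0, so a functional positive on any finite part of it exists. The
  finite part taken here expresses that each variable exceeds the unit monomial, which makes the
  weights positive, and that each leading monomial exceeds the other terms of its basis
  element.\<close>

lemma weights_exist:
  "\<exists>w :: 'x \<Rightarrow> real. (\<forall>x. 1 \<le> w x) \<and>
    (\<forall>s\<in>S. \<forall>m\<in>Poly_Mapping.keys s.
      (\<Sum>x\<in>UNIV. w x * real (Poly_Mapping.lookup m x)) \<le> (\<Sum>x\<in>UNIV. w x * real (Poly_Mapping.lookup (lead_mono r s) x)))"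
proof -
  define diff :: "'x monomial \<Rightarrow> 'x monomial \<Rightarrow> 'x \<Rightarrow> int"
    where "diff u v = (\<lambda>x. int (Poly_Mapping.lookup v x) - int (Poly_Mapping.lookup u x))" for u v
  define P where "P = {diff u v | u v. u \<prec> v}"
  define D where "D = (\<lambda>x. diff 0 (Poly_Mapping.single x 1)) ` UNIV \<union>
    (\<Union>s\<in>S. (\<lambda>m. diff m (lead_mono r s)) ` (Poly_Mapping.keys s - {lead_mono r s}))"
  have "finite D" using finite_basis by (auto simp: D_def)
  moreover have "D \<subseteq> P"
  proof -
    have "0 \<prec> Poly_Mapping.single x 1" for x :: 'x
      by (rule zero_mono_less) (metis lookup_single_eq lookup_zero zero_neq_one)
    moreover have "m \<prec> lead_mono r s" if "s \<in> S" "m \<in> Poly_Mapping.keys s - {lead_mono r s}" for m s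
      using lead_mono(2)[OF basis_nonzero[OF that(1)]] that(2) by simp
    ultimately show ?thesis unfolding D_def P_def by blast
  qed
  moreover have "(\<lambda>_. 0) \<notin> P"
  proof
    assume "(\<lambda>_. 0) \<in> P"
    then obtain u v where uv: "u \<prec> v" "diff u v = (\<lambda>_. 0)" by (auto simp: P_def)
    then have "u = v" by (intro poly_mapping_eqI) (simp add: diff_def fun_eq_iff)
    then show False using uv by simp
  qed
  moreover have "(\<lambda>x. f x + g x) \<in> P" if fg: "f \<in> P" "g \<in> P" for f g
  proof -
    obtain u v u' v' where *: "u \<prec> v" "u' \<prec> v'" "f = diff u v" "g = diff u' v'"
      using fg unfolding P_def by blast
    then have "u + u' \<prec> v + u'" "v + u' \<prec> v + v'"
      using mono_less_add by (metis add.commute)+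
    then have "u + u' \<prec> v + v'" by (rule mono_less_trans)
    moreover have "(\<lambda>x. f x + g x) = diff (u + u') (v + v')"
      by (simp add: * diff_def lookup_add fun_eq_iff)
    ultimately show ?thesis unfolding P_def by blast
  qed
  ultimately obtain w where w: "\<forall>d\<in>D. 0 < (\<Sum>x\<in>UNIV. w x * real_of_int (d x))"
    using positive_functional_exists[of UNIV D P] by auto
  have w_diff: "(\<Sum>x\<in>UNIV. w x * real_of_int (diff u v x)) =
     (\<Sum>x\<in>UNIV. w x * real (Poly_Mapping.lookup v x)) - (\<Sum>x\<in>UNIV. w x * real (Poly_Mapping.lookup u x))" for u v
    by (simp add: diff_def sum_subtractf[symmetric] algebra_simps)
  have pos: "0 < w x" for x
  proof -
    have "diff 0 (Poly_Mapping.single x 1) \<in> D" by (simp add: D_def)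
    from bspec[OF w this] show ?thesis
      by (simp add: w_diff lookup_single when_def if_distrib[of real] if_distrib[of "\<lambda>y. _ * y"] cong: if_cong)
  qed
  \<comment> \<open>Dividing by the smallest weight raises all weights to at least 1.\<close>
  define c where "c = Min (range w)"
  have c: "0 < c" "\<And>x. c \<le> w x" using pos by (auto simp: c_def)
  have le: "(\<Sum>x\<in>UNIV. w x * real (Poly_Mapping.lookup m x)) \<le> (\<Sum>x\<in>UNIV. w x * real (Poly_Mapping.lookup (lead_mono r s) x))"
    if "s \<in> S" "m \<in> Poly_Mapping.keys s" for s m
  proof (cases "m = lead_mono r s")
    case False
    then have "diff m (lead_mono r s) \<in> D" using that by (auto simp: D_def)
    from bspec[OF w this] show ?thesis by (simp add: w_diff)
  qed simp
  have scale: "(\<Sum>x\<in>UNIV. w x / c * real (Poly_Mapping.lookup m x)) = (\<Sum>x\<in>UNIV. w x * real (Poly_Mapping.lookup m x)) / c" for m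
    by (simp add: sum_divide_distrib)
  show ?thesis
  proof (intro exI conjI allI ballI)
    show "1 \<le> w x / c" for x using c by simp
    show "(\<Sum>x\<in>UNIV. w x / c * real (Poly_Mapping.lookup m x)) \<le>
        (\<Sum>x\<in>UNIV. w x / c * real (Poly_Mapping.lookup (lead_mono r s) x))"
      if "s \<in> S" "m \<in> Poly_Mapping.keys s" for s m
      unfolding scale using le[OF that] c by (intro divide_right_mono) auto
  qed
qed

section \<open>The quotient algebra and the coset map\<close>

abbreviation K :: "'k ring" where "K \<equiv> class_ring"

abbreviation A :: "('k, ('x, 'k) mpoly set) module" where "A \<equiv> quot_algebra (Id_gen S)"

definition quo :: "('x, 'k) mpoly \<Rightarrow> ('x, 'k) mpoly set" where
  "quo f = Id_gen S +>\<^bsub>class_ring\<^esub> f"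

lemma ideal: "ideal (Id_gen S) class_ring"
  using basis by (simp add: groebner_basis_def)

lemma vectorspace_quot: "vectorspace K A"
  using quot_algebra_algebra[OF ideal] class_field
  by (simp add: vectorspace_def algebra_def)

interpretation quot: algebra K A by (rule quot_algebra_algebra[OF ideal])

interpretation quot: vectorspace K A by (rule vectorspace_quot)

interpretation I: ideal "Id_gen S" class_ring by (rule ideal)

lemma ideal_zero: "0 \<in> Id_gen S"
  and ideal_add: "f \<in> Id_gen S \<Longrightarrow> g \<in> Id_gen S \<Longrightarrow> f + g \<in> Id_gen S"
  and ideal_diff: "f \<in> Id_gen S \<Longrightarrow> g \<in> Id_gen S \<Longrightarrow> f - g \<in> Id_gen S"
  and ideal_mult: "f \<in> Id_gen S \<Longrightarrow> f * g \<in> Id_gen S"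
  and basis_in_ideal: "s \<in> S \<Longrightarrow> s \<in> Id_gen S"
proof -
  show "0 \<in> Id_gen S" using I.zero_closed by simp
  show "f + g \<in> Id_gen S" if "f \<in> Id_gen S" "g \<in> Id_gen S" for f g
    using I.a_closed[OF that] by simp
  show mult: "f * g \<in> Id_gen S" if "f \<in> Id_gen S" for f g
    using I.I_r_closed[OF that, of g] by simp
  show "f - g \<in> Id_gen S" if "f \<in> Id_gen S" "g \<in> Id_gen S" for f g
    using I.a_closed[OF that(1) mult[OF that(2), of "-1"]] by simp
  show "s \<in> Id_gen S" if "s \<in> S" for s
    using ring.genideal_self[OF class_ring.ring_axioms, of S] that by auto
qed

lemma quo_eq_iff: "quo f = quo g \<longleftrightarrow> f - g \<in> Id_gen S"
proof
  have quo: "quo f = {h + f | h. h \<in> Id_gen S}" for f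
    by (auto simp: quo_def a_r_coset_def')
  show "f - g \<in> Id_gen S" if "quo f = quo g"
  proof -
    have "0 + f \<in> quo f" using ideal_zero unfolding quo by blast
    then show ?thesis using that unfolding quo by (auto simp: algebra_simps)
  qed
  assume fg: "f - g \<in> Id_gen S"
  have "h + f = (h + (f - g)) + g" "h + g = (h - (f - g)) + f" for h
    by simp_all
  then show "quo f = quo g"
    unfolding quo using ideal_add[OF _ fg] ideal_diff[OF _ fg] by blast
qed

lemma quot_algebra_sel:
  "carrier A = carrier (class_ring Quot Id_gen S)" "mult A = mult (class_ring Quot Id_gen S)"
  "one A = one (class_ring Quot Id_gen S)" "zero A = zero (class_ring Quot Id_gen S)"
  "add A = add (class_ring Quot Id_gen S)"
  "smult A = (\<lambda>c F. quo (const_poly c) \<otimes>\<^bsub>A\<^esub> F)"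
  by (simp_all add: quot_algebra_def ring.extend_def quo_def)

lemma quo_hom: "quo \<in> Ring.ring_hom class_ring (class_ring Quot Id_gen S)"
  using I.rcos_ring_hom by (simp add: quo_def[abs_def])

lemma carrier_quot: "carrier A = range quo"
  by (simp add: quot_algebra_sel FactRing_def A_RCOSETS_def' quo_def image_def) blast

lemma quo_add: "quo f \<oplus>\<^bsub>A\<^esub> quo g = quo (f + g)"
  and quo_mult: "quo f \<otimes>\<^bsub>A\<^esub> quo g = quo (f * g)"
  and quo_one: "\<one>\<^bsub>A\<^esub> = quo 1"
  and quo_smult: "c \<odot>\<^bsub>A\<^esub> quo f = quo (const_poly c * f)"
  using ring_hom_add[OF quo_hom, of f g] ring_hom_mult[OF quo_hom] ring_hom_one[OF quo_hom]
  by (simp_all add: quot_algebra_sel)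

lemma quo_zero: "\<zero>\<^bsub>A\<^esub> = quo 0"
  using ideal_zero by (auto simp: quot_algebra_sel FactRing_def quo_def a_r_coset_def')

lemma quo_closed: "quo f \<in> carrier A"
  by (simp add: carrier_quot)

lemma quo_finsum:
  "finite M \<Longrightarrow> finsum A (\<lambda>m. quo (f m)) M = quo (\<Sum>m\<in>M. f m)"
  by (induction M rule: finite_induct) (auto simp: quo_zero quo_closed quo_add quot.finsum_insert)

lemma quo_in_submodule:
  assumes W: "submodule K W A" and "\<And>m. m \<in> Poly_Mapping.keys f \<Longrightarrow> quo (mono_poly m) \<in> W"
  shows "quo f \<in> W"
proof (rule poly_mapping_closure[where P = "\<lambda>f. quo f \<in> W" and f = f])
  show "quo 0 \<in> W" using submodule.zero_closed[OF W] by (simp add: quo_zero)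
  show "quo (g + h) \<in> W" if "quo g \<in> W" "quo h \<in> W" for g h
    using submodule.m_closed[OF W that] by (simp add: quo_add)
  show "quo (Poly_Mapping.single m (Poly_Mapping.lookup f m)) \<in> W" if "m \<in> Poly_Mapping.keys f" for m
    using submodule.smult_closed[OF W _ assms(2)[OF that], of "Poly_Mapping.lookup f m"]
    by (simp add: quo_smult mult_single)
qed

text \<open>The difference of two irreducible monomials with equal cosets lies in the ideal and has
  irreducible keys only, so it is 0. Counting monomials and counting their cosets thus
  agree.\<close>

lemma inj_on_quo_mono: "inj_on (\<lambda>m. quo (mono_poly m)) (Irr r S)"
proof (rule inj_onI)
  fix m m' assume m: "m \<in> Irr r S" "m' \<in> Irr r S" and "quo (mono_poly m) = quo (mono_poly m')"
  then have "mono_poly m - mono_poly m' \<in> Id_gen S" by (simp add: quo_eq_iff)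
  moreover have "Poly_Mapping.keys (mono_poly m - mono_poly m' :: ('x, 'k) mpoly) \<subseteq> Irr r S"
    using m by (auto simp: in_keys_iff lookup_minus lookup_single when_def split: if_splits)
  ultimately have "mono_poly m = (mono_poly m' :: ('x, 'k) mpoly)" using ideal_Irr_eq_0 by fastforce
  then show "m = m'" by (metis lookup_single_eq lookup_single_not_eq zero_neq_one)
qed

text \<open>A vanishing combination lifts to an ideal element supported on irreducible monomials,
  which must be 0 together with all its coefficients.\<close>

lemma lin_indpt_Irr:
  assumes M: "finite M" "M \<subseteq> Irr r S"
  shows "quot.lin_indpt ((\<lambda>m. quo (mono_poly m)) ` M)"
proof (rule quot.finite_lin_indpt2)
  let ?q = "\<lambda>m. quo (mono_poly m)"
  have inj: "inj_on ?q M" using inj_on_quo_mono M(2) by (rule inj_on_subset)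
  fix a assume 0: "quot.lincomb a (?q ` M) = \<zero>\<^bsub>A\<^esub>"
  \<comment> \<open>The coefficients of the combination are indexed by cosets; injectivity on
    \<open>M\<close> lets \<open>f\<close> carry them back to monomials.\<close>
  define f where "f = (\<Sum>m\<in>M. Poly_Mapping.single m (a (?q m)))"
  have "quot.lincomb a (?q ` M) = finsum A (\<lambda>F. a F \<odot>\<^bsub>A\<^esub> F) (?q ` M)"
    by (simp add: quot.lincomb_def)
  also have "\<dots> = finsum A (\<lambda>m. a (?q m) \<odot>\<^bsub>A\<^esub> ?q m) M"
    using inj by (intro quot.finsum_reindex) (auto simp: quo_smult quo_closed)
  also have "\<dots> = quo f"
    by (simp add: quo_smult mult_single quo_finsum[OF M(1)] f_def)
  finally have "quo f = quo 0"
    using 0 by (simp add: quo_zero)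
  then have "f \<in> Id_gen S"
    using quo_eq_iff[of f 0] by simp
  moreover have lookup: "Poly_Mapping.lookup f m = (if m \<in> M then a (?q m) else 0)" for m
    using M(1) by (simp add: f_def lookup_sum lookup_single when_def)
  then have "Poly_Mapping.keys f \<subseteq> Irr r S"
    using M(2) by (auto simp: in_keys_iff split: if_splits)
  ultimately have "f = 0" by (rule ideal_Irr_eq_0)
  then show "\<forall>v\<in>?q ` M. a v = \<zero>\<^bsub>K\<^esub>"
    using lookup by (metis (no_types, lifting) image_iff lookup_zero ring.simps(1) ring_record_simps(11))
qed (use M quo_closed in auto)

lemma foldr_mult_closed:
  "set vs \<subseteq> carrier A \<Longrightarrow> foldr (\<otimes>\<^bsub>A\<^esub>) vs \<one>\<^bsub>A\<^esub> \<in> carrier A"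
  by (induction vs) auto

lemma nfold_products_closed:
  "V \<subseteq> carrier A \<Longrightarrow> nfold_products A V n \<subseteq> carrier A"
  using foldr_mult_closed by (fastforce simp: nfold_products_def)

lemma subspace_pow_subspace:
  "V \<subseteq> carrier A \<Longrightarrow> VectorSpace.subspace K (subspace_pow K A V n) A"
  unfolding subspace_pow_def by (intro quot.span_is_subspace nfold_products_closed)

text \<open>Links the sum of sets in \<open>subspace_pow_upto\<close> to the submodule sum, for
  which closure of subspaces is known.\<close>

lemma set_add_quot: "U \<subseteq> carrier A \<Longrightarrow> W \<subseteq> carrier A \<Longrightarrow> U <+>\<^bsub>A\<^esub> W = quot.submodule_sum U W"
  by (auto simp: quot.submodule_sum_def set_add_def')

lemma subspace_carrier: "VectorSpace.subspace K W A \<Longrightarrow> W \<subseteq> carrier A"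
  by (simp add: VectorSpace.subspace_def submodule_def)

lemma subspace_pow_upto_subspace:
  assumes "V \<subseteq> carrier A"
  shows "VectorSpace.subspace K (subspace_pow_upto K A V n) A"
proof (induction n)
  case 0
  have "VectorSpace.subspace K (quot.span {}) A" by (rule quot.span_is_subspace) simp
  then show ?case by (simp add: quot.span_empty)
next
  case (Suc n)
  then show ?case
    using quot.sum_is_subspace[OF Suc subspace_pow_subspace[OF assms]]
    by (simp add: set_add_quot subspace_carrier subspace_pow_subspace assms del: One_nat_def)
qed

section \<open>Counting irreducible monomials\<close>

lemma lead_mono_le_C_bound:
  assumes "s \<in> S"
  shows "Poly_Mapping.lookup (lead_mono r s) x \<le> C_bound r S"
proof -
  let ?P = "\<lambda>n. \<forall>s \<in> S. mono_divides (lead_mono r s) (\<Sum>x \<in> UNIV. Poly_Mapping.single x n)"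
  \<comment> \<open>Some number must satisfy the condition before the least one can be used; the sum
    of all exponents of all leading monomials dominates each of them.\<close>
  define n where "n = (\<Sum>s\<in>S. \<Sum>x\<in>UNIV. Poly_Mapping.lookup (lead_mono r s) x)"
  have "?P n"
  proof
    fix s assume s: "s \<in> S"
    have "Poly_Mapping.lookup (lead_mono r s) x \<le> n" for x
    proof -
      have "Poly_Mapping.lookup (lead_mono r s) x \<le> (\<Sum>x\<in>UNIV. Poly_Mapping.lookup (lead_mono r s) x)"
        by (rule member_le_sum) auto
      also have "\<dots> \<le> n" unfolding n_def using s finite_basis by (intro member_le_sum) auto
      finally show ?thesis .
    qed
    then have "lead_mono r s + ((\<Sum>x \<in> UNIV. Poly_Mapping.single x n) - lead_mono r s) =
      (\<Sum>x \<in> UNIV. Poly_Mapping.single x n)"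
      by (intro nat_poly_mapping_le_add_diff) (simp add: lookup_sum_single)
    then show "mono_divides (lead_mono r s) (\<Sum>x \<in> UNIV. Poly_Mapping.single x n)"
      unfolding mono_divides_def by metis
  qed
  then have "?P (LEAST n. ?P n)" by (rule LeastI)
  moreover have "C_bound r S = (LEAST n. ?P n)" using assms by (auto simp: C_bound_def)
  ultimately have "?P (C_bound r S)" by simp
  then obtain v where v: "(\<Sum>x \<in> UNIV. Poly_Mapping.single x (C_bound r S)) = lead_mono r s + v"
    using assms by (auto simp: mono_divides_def)
  have "C_bound r S = Poly_Mapping.lookup (lead_mono r s) x + Poly_Mapping.lookup v x"
    using arg_cong[OF v, of "\<lambda>m. Poly_Mapping.lookup m x"]
    by (simp add: lookup_sum_single lookup_add)
  then show ?thesis by simp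
qed

text \<open>The exponent \<open>C_bound r S + 1\<close> exceeds every exponent of a leading monomial
  and stands for a direction in which the exponent may grow without limit.\<close>

definition corner_Irr :: "'x monomial set" where
  "corner_Irr = {u \<in> Irr r S. \<forall>i. Poly_Mapping.lookup u i \<in> {0, C_bound r S + 1}}"

definition corner_deg :: nat where "corner_deg = Sdeg r S corner_Irr"

lemma finite_Sdeg_mono_image: "finite (Sdeg_mono r S ` B)"
proof -
  have "Sdeg_mono r S ` B \<subseteq> {..card (UNIV :: 'x set)}"
    by (auto simp: Sdeg_mono_def intro: card_mono)
  then show ?thesis by (rule finite_subset) simp
qed

lemma Sdeg_mono_le_Sdeg: "u \<in> B \<Longrightarrow> Sdeg_mono r S u \<le> Sdeg r S B"
  using finite_Sdeg_mono_image by (auto simp: Sdeg_def)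

text \<open>Lowering the large exponents of \<open>u\<close> to \<open>C_bound r S + 1\<close> and
  the others to 0 gives a divisor of \<open>u\<close>. It is again irreducible, hence a corner, and
  has the same large directions.\<close>

lemma card_large_exponents_le:
  assumes "u \<in> Irr r S"
  shows "card {x. C_bound r S < Poly_Mapping.lookup u x} \<le> corner_deg"
proof -
  let ?D = "{x. C_bound r S < Poly_Mapping.lookup u x}"
  define v where "v = (\<Sum>x\<in>?D. Poly_Mapping.single x (C_bound r S + 1))"
  have v: "Poly_Mapping.lookup v y = (if y \<in> ?D then C_bound r S + 1 else 0)" for y
    unfolding v_def by (rule lookup_sum_single)
  then have "v + (u - v) = u"
    by (intro nat_poly_mapping_le_add_diff) simp
  then have "v \<in> Irr r S" using assms Irr_downward by metis
  then have "v \<in> corner_Irr" using v by (simp add: corner_Irr_def)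
  moreover have "Sdeg_mono r S v = card ?D"
    unfolding Sdeg_mono_def by (rule arg_cong[where f = card]) (auto simp: v)
  ultimately show ?thesis using Sdeg_mono_le_Sdeg[of v corner_Irr] by (simp add: corner_deg_def)
qed

text \<open>Sorting the monomials by their set \<open>D\<close> of large directions covers them by
  boxes with side \<open>N + 1\<close> along \<open>D\<close> and \<open>C_bound r S + 1\<close>
  elsewhere. There are at most 2 to the number of variables such \<open>D\<close>, each of size at
  most \<open>corner_deg\<close>; only the exponent of \<open>N + 1\<close> matters later.\<close>

lemma card_Irr_box_le:
  "finite {u \<in> Irr r S. \<forall>x. Poly_Mapping.lookup u x \<le> N}"
  "card {u \<in> Irr r S. \<forall>x. Poly_Mapping.lookup u x \<le> N} \<le> 2 ^ card (UNIV :: 'x set) * (C_bound r S + 1) ^ card (UNIV :: 'x set) * (N + 1) ^ corner_deg"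
proof -
  let ?C = "C_bound r S"
  define box where "box D = {u :: 'x monomial. \<forall>x. Poly_Mapping.lookup u x \<in> (if x \<in> D then {..N} else {..?C})}" for D
  define \<D> where "\<D> = {D :: 'x set. card D \<le> corner_deg}"
  have sub: "{u \<in> Irr r S. \<forall>x. Poly_Mapping.lookup u x \<le> N} \<subseteq> (\<Union>D\<in>\<D>. box D)"
  proof
    fix u assume "u \<in> {u \<in> Irr r S. \<forall>x. Poly_Mapping.lookup u x \<le> N}"
    then have "{x. ?C < Poly_Mapping.lookup u x} \<in> \<D>" "u \<in> box {x. ?C < Poly_Mapping.lookup u x}"
      using card_large_exponents_le by (auto simp: \<D>_def box_def)
    then show "u \<in> (\<Union>D\<in>\<D>. box D)" by blast
  qed
  have fin: "finite (box D)" for D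
    unfolding box_def by (rule card_poly_mapping_box(1)) simp
  have card: "card (box D) \<le> (?C + 1) ^ card (UNIV :: 'x set) * (N + 1) ^ corner_deg" if "D \<in> \<D>" for D
  proof -
    have "card (box D) = (\<Prod>x\<in>UNIV. if x \<in> D then N + 1 else ?C + 1)"
      unfolding box_def by (subst card_poly_mapping_box(2)) (auto intro: prod.cong)
    also have "\<dots> = (N + 1) ^ card D * (?C + 1) ^ card (- D)"
      by (simp add: prod.If_cases)
    also have "\<dots> \<le> (N + 1) ^ corner_deg * (?C + 1) ^ card (UNIV :: 'x set)"
      using that by (intro mult_mono power_increasing) (auto simp: \<D>_def intro: card_mono)
    finally show ?thesis by (simp add: mult.commute)
  qed
  have fin\<D>: "finite \<D>" by (rule finite_subset[of _ UNIV]) auto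
  show "finite {u \<in> Irr r S. \<forall>x. Poly_Mapping.lookup u x \<le> N}"
    using sub by (rule finite_subset) (use fin fin\<D> in blast)
  have "card {u \<in> Irr r S. \<forall>x. Poly_Mapping.lookup u x \<le> N} \<le> card (\<Union>D\<in>\<D>. box D)"
    using sub fin fin\<D> by (intro card_mono) auto
  also have "\<dots> \<le> (\<Sum>D\<in>\<D>. card (box D))" using fin\<D> by (rule card_UN_le)
  also have "\<dots> \<le> card \<D> * ((?C + 1) ^ card (UNIV :: 'x set) * (N + 1) ^ corner_deg)"
    using sum_bounded_above[OF card] by simp
  also have "card \<D> \<le> 2 ^ card (UNIV :: 'x set)"
    using card_mono[of "Pow UNIV" \<D>] by (auto simp: card_Pow simp del: Pow_UNIV)
  finally show "card {u \<in> Irr r S. \<forall>x. Poly_Mapping.lookup u x \<le> N} \<le> 2 ^ card (UNIV :: 'x set) * (?C + 1) ^ card (UNIV :: 'x set) * (N + 1) ^ corner_deg"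
    by (simp add: mult.assoc)
qed

text \<open>A leading monomial dividing \<open>v\<close> has exponent 0 in the small directions of
  \<open>u\<close> and at most \<open>C_bound r S\<close> in the large ones. It would therefore
  divide \<open>u\<close> as well.\<close>

lemma Irr_if_support_large:
  assumes u: "u \<in> Irr r S" and v: "\<And>x. Poly_Mapping.lookup u x \<le> C_bound r S \<Longrightarrow> Poly_Mapping.lookup v x = 0"
  shows "v \<in> Irr r S"
proof (rule ccontr)
  assume "v \<notin> Irr r S"
  then obtain s v' where s: "s \<in> S" "v = lead_mono r s + v'" by (auto simp: Irr_iff)
  have "Poly_Mapping.lookup (lead_mono r s) x \<le> Poly_Mapping.lookup u x" for x
    using v[of x] lead_mono_le_C_bound[OF s(1), of x] s(2)
    by (cases "Poly_Mapping.lookup u x \<le> C_bound r S") (auto simp: lookup_add)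
  then have "u = lead_mono r s + (u - lead_mono r s)"
    by (simp add: nat_poly_mapping_le_add_diff)
  then show False using u s(1) unfolding Irr_iff by blast
qed

end

section \<open>Growth of the quotient algebra\<close>

text \<open>The weight stays a parameter, to be supplied by \<open>weights_exist\<close>. The lower
  bound 1 makes the weight control the exponents; the second assumption says that reduction does not
  raise it.\<close>

locale weighted_groebner = groebner r S
  for r :: "('x::finite) monomial rel" and S :: "('x, 'k::field) mpoly set" +
  fixes w :: "'x \<Rightarrow> real"
  assumes weight_ge_1: "1 \<le> w x"
    and weight_lead: "s \<in> S \<Longrightarrow> m \<in> Poly_Mapping.keys s \<Longrightarrow>
      (\<Sum>x\<in>UNIV. w x * real (Poly_Mapping.lookup m x)) \<le> (\<Sum>x\<in>UNIV. w x * real (Poly_Mapping.lookup (lead_mono r s) x))"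
begin

interpretation quot: algebra K A by (rule quot_algebra_algebra[OF ideal])

interpretation quot: vectorspace K A by (rule vectorspace_quot)

section \<open>The weight filtration\<close>

definition wt :: "'x monomial \<Rightarrow> real" where
  "wt m = (\<Sum>x\<in>UNIV. w x * real (Poly_Mapping.lookup m x))"

lemma wt_add: "wt (u + v) = wt u + wt v"
  by (simp add: wt_def lookup_add algebra_simps sum.distrib)

lemma wt_zero: "wt 0 = 0"
  by (simp add: wt_def)

lemma wt_nonneg: "0 \<le> wt m"
  unfolding wt_def using weight_ge_1 by (intro sum_nonneg mult_nonneg_nonneg) (auto intro: order_trans[OF zero_le_one])

lemma exponent_le_wt: "real (Poly_Mapping.lookup m x) \<le> wt m"
proof -
  have "real (Poly_Mapping.lookup m x) \<le> w x * real (Poly_Mapping.lookup m x)"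
    using weight_ge_1[of x] by (simp add: mult_le_cancel_right1)
  also have "\<dots> \<le> wt m"
    unfolding wt_def
    by (rule member_le_sum) (use weight_ge_1 in \<open>auto intro!: mult_nonneg_nonneg intro: order_trans[OF zero_le_one]\<close>)
  finally show ?thesis .
qed

lemma wt_keys_le_lead: "s \<in> S \<Longrightarrow> m \<in> Poly_Mapping.keys s \<Longrightarrow> wt m \<le> wt (lead_mono r s)"
  unfolding wt_def by (rule weight_lead)

text \<open>Reduction modulo \<open>S\<close>, as an induction along the monomial order: a reducible
  \<open>m\<close> is replaced by monomials that are smaller in the order and not heavier, so the
  bound \<open>N\<close> persists.\<close>

lemma quo_mono_in_span_Irr:
  assumes "wt m \<le> N"
  shows "quo (mono_poly m) \<in> quot.span ((\<lambda>u. quo (mono_poly u)) ` {u \<in> Irr r S. wt u \<le> N})"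
  using wf_mono_less assms
proof (induction m rule: wf_induct_rule)
  case (less m)
  let ?Q = "(\<lambda>u. quo (mono_poly u)) ` {u \<in> Irr r S. wt u \<le> N}"
  have Q: "?Q \<subseteq> carrier A" using quo_closed by auto
  show ?case
  proof (cases "m \<in> Irr r S")
    case True
    then show ?thesis using quot.in_own_span[OF Q] less.prems by blast
  next
    case False
    then obtain s v where s: "s \<in> S" and m: "m = lead_mono r s + v"
      by (auto simp: Irr_iff)
    \<comment> \<open>Since \<open>s\<close> is monic, the subtraction cancels \<open>m\<close>;
      what remains comes from the lower terms of \<open>s\<close>, shifted by
      \<open>v\<close>.\<close>
    define h :: "('x, 'k) mpoly" where "h = mono_poly m - s * mono_poly v"
    have "mono_poly m - h \<in> Id_gen S"
      using ideal_mult[OF basis_in_ideal[OF s]] by (simp add: h_def)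
    then have "quo (mono_poly m) = quo h" by (simp add: quo_eq_iff)
    moreover have "quo h \<in> quot.span ?Q"
    proof (rule quo_in_submodule)
      show "submodule K (quot.span ?Q) A" using Q by (rule quot.span_is_submodule)
      fix k assume k: "k \<in> Poly_Mapping.keys h"
      have "Poly_Mapping.lookup h m = 0"
        using basis_monic[OF s] by (simp add: h_def lookup_minus m lookup_times_single)
      then have "k \<noteq> m" using k by (auto simp: in_keys_iff)
      then have "k \<in> Poly_Mapping.keys (s * mono_poly v)"
        using k by (auto simp: h_def in_keys_iff lookup_minus lookup_single)
      then obtain k' where k': "k' \<in> Poly_Mapping.keys s" "k = k' + v"
        by (auto simp: keys_times_single)
      with \<open>k \<noteq> m\<close> m have "k' \<prec> lead_mono r s"
        using lead_mono(2)[OF basis_nonzero[OF s]] by blast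
      then have "k \<prec> m" using mono_less_add[of k' "lead_mono r s" v] by (metis k'(2) m add.commute)
      moreover have "wt k \<le> wt m"
        using wt_keys_le_lead[OF s k'(1)] by (simp add: k' m wt_add)
      ultimately show "quo (mono_poly k) \<in> quot.span ?Q"
        using less.IH less.prems by simp
    qed
    ultimately show ?thesis by simp
  qed
qed

text \<open>One representative of weight at most \<open>N\<close> suffices, and it need not be
  reduced. This makes the filtration multiplicative by additivity of the weight alone.\<close>

definition filtration :: "nat \<Rightarrow> ('x, 'k) mpoly set set" where
  "filtration N = quo ` {f. \<forall>m\<in>Poly_Mapping.keys f. wt m \<le> real N}"

lemma filtration_submodule: "submodule K (filtration N) A"
proof
  show "filtration N \<subseteq> carrier A" by (auto simp: filtration_def quo_closed)
  show "F \<oplus>\<^bsub>A\<^esub> G \<in> filtration N" if "F \<in> filtration N" "G \<in> filtration N" for F G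
    using that by (auto simp: filtration_def quo_add dest!: keys_add[THEN subsetD] intro!: imageI)
  show "\<zero>\<^bsub>A\<^esub> \<in> filtration N"
    by (auto simp: filtration_def quo_zero intro!: imageI)
  show "c \<odot>\<^bsub>A\<^esub> F \<in> filtration N" if "F \<in> filtration N" for c F
  proof -
    have "Poly_Mapping.keys (const_poly c * f) \<subseteq> Poly_Mapping.keys f" for f :: "('x, 'k) mpoly"
      using keys_mult[of "const_poly c" f] by (auto split: if_splits)
    then show ?thesis using that by (fastforce simp: filtration_def quo_smult)
  qed
qed

lemma filtration_mult:
  assumes "F \<in> filtration N" "G \<in> filtration M"
  shows "F \<otimes>\<^bsub>A\<^esub> G \<in> filtration (N + M)"
proof -
  obtain f g where fg: "F = quo f" "G = quo g" "\<forall>m\<in>Poly_Mapping.keys f. wt m \<le> real N"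
    "\<forall>m\<in>Poly_Mapping.keys g. wt m \<le> real M"
    using assms by (auto simp: filtration_def)
  then have "wt m \<le> real (N + M)" if "m \<in> Poly_Mapping.keys (f * g)" for m
    using keys_mult[of f g] that by (fastforce simp: wt_add intro: add_mono)
  then show ?thesis by (auto simp: fg quo_mult filtration_def)
qed

lemma filtration_mono: "N \<le> M \<Longrightarrow> filtration N \<subseteq> filtration M"
  by (fastforce simp: filtration_def)

lemma foldr_mult_filtration:
  "set vs \<subseteq> filtration N \<Longrightarrow> foldr (\<otimes>\<^bsub>A\<^esub>) vs \<one>\<^bsub>A\<^esub> \<in> filtration (length vs * N)"
proof (induction vs)
  case Nil
  then show ?case by (auto simp: quo_one filtration_def wt_zero intro!: imageI)
next
  case (Cons v vs)
  then show ?case using filtration_mult[of v N _ "length vs * N"] by simp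
qed

lemma subspace_pow_upto_filtration:
  assumes "V \<subseteq> filtration N"
  shows "subspace_pow_upto K A V n \<subseteq> filtration (n * N)"
proof (induction n)
  case 0
  then show ?case using submodule.zero_closed[OF filtration_submodule] by simp
next
  case (Suc n)
  have "nfold_products A V (Suc n) \<subseteq> filtration (Suc n * N)"
    using foldr_mult_filtration assms unfolding nfold_products_def by fastforce
  then have "subspace_pow K A V (Suc n) \<subseteq> filtration (Suc n * N)"
    unfolding subspace_pow_def using filtration_submodule by (rule quot.span_is_subset)
  moreover have "subspace_pow_upto K A V n \<subseteq> filtration (Suc n * N)"
    using Suc filtration_mono[of "n * N" "Suc n * N"] by auto
  ultimately show ?case
    using submodule.m_closed[OF filtration_submodule] by (fastforce simp: set_add_def')
qed

text \<open>Each element has a representative with finitely many terms, whose weights are bounded by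
  their sum; the levels increase, so a maximum serves a finite set.\<close>

lemma finite_subset_filtration:
  assumes "finite B" "B \<subseteq> carrier A"
  shows "\<exists>N. B \<subseteq> filtration N"
  using assms
proof (induction B rule: finite_induct)
  case (insert F B)
  then obtain N f where N: "B \<subseteq> filtration N" and f: "F = quo f"
    by (auto simp: carrier_quot)
  obtain M where M: "(\<Sum>m\<in>Poly_Mapping.keys f. wt m) \<le> real M"
    using real_arch_simple by blast
  have "wt m \<le> real M" if "m \<in> Poly_Mapping.keys f" for m
    using member_le_sum[OF that, of wt] M wt_nonneg by simp
  then have "F \<in> filtration M" by (auto simp: f filtration_def)
  then have "insert F B \<subseteq> filtration (max N M)"
    using N filtration_mono[of N "max N M"] filtration_mono[of M "max N M"] by auto
  then show ?case by blast
qed simp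

text \<open>Level \<open>N\<close> is spanned by irreducible monomials of weight at most
  \<open>N\<close>. As every weight is at least 1, their exponents are at most \<open>N\<close> too,
  and \<open>card_Irr_box_le\<close> counts them.\<close>

lemma dim_subspace_filtration_le:
  assumes W: "VectorSpace.subspace K W A" "W \<subseteq> filtration N"
  shows "vectorspace.fin_dim K (A\<lparr>carrier := W\<rparr>)"
    and "vectorspace.dim K (A\<lparr>carrier := W\<rparr>) \<le>
      2 ^ card (UNIV :: 'x set) * (C_bound r S + 1) ^ card (UNIV :: 'x set) * (N + 1) ^ corner_deg"
proof -
  let ?E = "{u \<in> Irr r S. wt u \<le> real N}" and ?q = "\<lambda>u. quo (mono_poly u)"
  have sub: "?E \<subseteq> {u \<in> Irr r S. \<forall>x. Poly_Mapping.lookup u x \<le> N}"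
  proof clarify
    fix u x assume "wt u \<le> real N"
    then have "real (Poly_Mapping.lookup u x) \<le> real N"
      using exponent_le_wt[of u x] by (rule order_trans[rotated])
    then show "Poly_Mapping.lookup u x \<le> N" by simp
  qed
  then have fin: "finite ?E" using card_Irr_box_le(1) finite_subset by blast
  have Q: "?q ` ?E \<subseteq> carrier A" using quo_closed by auto
  have "filtration N \<subseteq> quot.span (?q ` ?E)"
    using quo_in_submodule[OF quot.span_is_submodule[OF Q]] quo_mono_in_span_Irr
    by (auto simp: filtration_def)
  then have *: "W \<subseteq> quot.span (?q ` ?E)" using W(2) by blast
  show "vectorspace.fin_dim K (A\<lparr>carrier := W\<rparr>)"
    using quot.subspace_dim_le_card(1)[OF W(1) _ Q *] fin by simp
  have "vectorspace.dim K (A\<lparr>carrier := W\<rparr>) \<le> card (?q ` ?E)"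
    using quot.subspace_dim_le_card(2)[OF W(1) _ Q *] fin by simp
  also have "\<dots> \<le> card ?E" using fin by (rule card_image_le)
  also have "\<dots> \<le> card {u \<in> Irr r S. \<forall>x. Poly_Mapping.lookup u x \<le> N}"
    using card_Irr_box_le(1) sub by (rule card_mono)
  also note card_Irr_box_le(2)
  finally show "vectorspace.dim K (A\<lparr>carrier := W\<rparr>) \<le>
      2 ^ card (UNIV :: 'x set) * (C_bound r S + 1) ^ card (UNIV :: 'x set) * (N + 1) ^ corner_deg" .
qed

section \<open>Upper bound for the growth\<close>

lemma limsup_dim_le:
  assumes V: "VectorSpace.subspace K V A" "vectorspace.fin_dim K (A\<lparr>carrier := V\<rparr>)"
  shows "limsup (\<lambda>n. ereal (log (real n)
     (real (vectorspace.dim K (A\<lparr>carrier := subspace_pow_upto K A V n\<rparr>))))) \<le> ereal (real corner_deg)"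
proof -
  interpret V: vectorspace K "A\<lparr>carrier := V\<rparr>" by (rule quot.subspace_is_vs[OF V(1)])
  have VA: "V \<subseteq> carrier A" by (rule subspace_carrier[OF V(1)])
  obtain B where B: "finite B" "B \<subseteq> V" "V.span B = V"
    using V(2) by (auto simp: V.fin_dim_def)
  \<comment> \<open>A finite spanning set lies in one level \<open>N\<close>, hence so does
    \<open>V\<close>, and products of length \<open>n\<close> lie in level
    \<open>n * N\<close>.\<close>
  then obtain N where N: "B \<subseteq> filtration N"
    using finite_subset_filtration VA by (meson subset_trans)
  have "quot.span B = V"
    using B quot.span_li_not_depend(1)[OF B(2) quot.is_module[OF V(1)]] by simp
  then have VN: "V \<subseteq> filtration N"
    using quot.span_is_subset[OF N filtration_submodule] by simp
  \<comment> \<open>One constant serves all positive \<open>n\<close>, because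
    \<open>n * N + 1 \<le> (N + 1) * n\<close>.\<close>
  define c where "c = 2 ^ card (UNIV :: 'x set) * (C_bound r S + 1) ^ card (UNIV :: 'x set) * (N + 1) ^ corner_deg"
  have "0 < c" by (simp add: c_def)
  let ?dim = "\<lambda>n. vectorspace.dim K (A\<lparr>carrier := subspace_pow_upto K A V n\<rparr>)"
  have le: "?dim n \<le> c * n ^ corner_deg" if "0 < n" for n
  proof -
    have "?dim n \<le> 2 ^ card (UNIV :: 'x set) * (C_bound r S + 1) ^ card (UNIV :: 'x set) * (n * N + 1) ^ corner_deg"
      by (intro dim_subspace_filtration_le(2) subspace_pow_upto_subspace VA subspace_pow_upto_filtration VN)
    also have "\<dots> \<le> 2 ^ card (UNIV :: 'x set) * (C_bound r S + 1) ^ card (UNIV :: 'x set) * ((N + 1) * n) ^ corner_deg"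
      using that by (intro mult_left_mono power_mono) auto
    finally show ?thesis by (simp only: c_def power_mult_distrib mult.assoc)
  qed
  have "\<forall>\<^sub>F n in sequentially. ereal (log (real n) (real (?dim n))) \<le> ereal (log (real n) (real c * real n ^ corner_deg))"
    using eventually_gt_at_top[of 1]
  proof eventually_elim
    case (elim n)
    then have n: "1 < real n" by simp
    have pos: "1 \<le> real c * real n ^ corner_deg"
      using \<open>0 < c\<close> n one_le_power[of "real n" corner_deg] by (intro mult_ge1_I) auto
    show ?case
    \<comment> \<open>Monotonicity of \<open>log\<close> asks for positive arguments; at dimension 0
      the value is 0 by convention.\<close>
    proof (cases "?dim n = 0")
      case True
      then show ?thesis using pos n by (simp add: log_def)
    next
      case False
      have "real (?dim n) \<le> real (c * n ^ corner_deg)"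
        using le[of n] elim by (intro of_nat_mono) simp
      then show ?thesis using False n pos by (simp add: log_le_cancel_iff)
    qed
  qed
  then have "limsup (\<lambda>n. ereal (log (real n) (real (?dim n)))) \<le> limsup (\<lambda>n. ereal (log (real n) (real c * real n ^ corner_deg)))"
    by (rule Limsup_mono)
  also have "\<dots> = ereal (real corner_deg)"
    using tendsto_log_const_mult_power[of "real c" corner_deg] \<open>0 < c\<close>
    by (intro lim_imp_Limsup) (auto simp: tendsto_ereal)
  finally show ?thesis .
qed

section \<open>Lower bound for the growth\<close>

definition generators :: "('x, 'k) mpoly set set" where
  "generators = (\<lambda>m. quo (mono_poly m)) ` insert 0 (range (\<lambda>x. Poly_Mapping.single x 1))"

lemma generators: "finite generators" "generators \<subseteq> carrier A"
  using quo_closed by (auto simp: generators_def)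

text \<open>Variables are split off one at a time. Once the monomial is used up, the coset of 1,
  which belongs to \<open>generators\<close> for this purpose, pads the product to length exactly
  \<open>n\<close>.\<close>

lemma quo_mono_eq_product:
  assumes "(\<Sum>x\<in>UNIV. Poly_Mapping.lookup m x) \<le> n"
  shows "\<exists>vs. length vs = n \<and> set vs \<subseteq> generators \<and> foldr (\<otimes>\<^bsub>A\<^esub>) vs \<one>\<^bsub>A\<^esub> = quo (mono_poly m)"
  using assms
proof (induction n arbitrary: m)
  case 0
  then have "m = 0" by (intro poly_mapping_eqI) simp
  then show ?case by (simp add: quo_one)
next
  case (Suc n)
  show ?case
  proof (cases "m = 0")
    case True
    obtain vs where "length vs = n" "set vs \<subseteq> generators" "foldr (\<otimes>\<^bsub>A\<^esub>) vs \<one>\<^bsub>A\<^esub> = quo (mono_poly 0)"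
      using Suc.IH[of 0] by auto
    then show ?thesis
      using True by (intro exI[of _ "quo (mono_poly 0) # vs"]) (simp add: generators_def quo_mult)
  next
    case False
    then obtain x where x: "Poly_Mapping.lookup m x \<noteq> 0"
      by (metis lookup_zero poly_mapping_eqI)
    define m' where "m' = m - Poly_Mapping.single x 1"
    have m: "Poly_Mapping.single x 1 + m' = m"
      unfolding m'_def
      by (rule nat_poly_mapping_le_add_diff) (use x in \<open>auto simp: lookup_single when_def\<close>)
    have "(\<Sum>y\<in>UNIV. Poly_Mapping.lookup m y) = 1 + (\<Sum>y\<in>UNIV. Poly_Mapping.lookup m' y)"
      by (subst m[symmetric]) (simp add: lookup_add lookup_single when_def sum.distrib)
    then obtain vs where "length vs = n" "set vs \<subseteq> generators" "foldr (\<otimes>\<^bsub>A\<^esub>) vs \<one>\<^bsub>A\<^esub> = quo (mono_poly m')"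
      using Suc.IH[of m'] Suc.prems by auto
    then show ?thesis
      by (intro exI[of _ "quo (mono_poly (Poly_Mapping.single x 1)) # vs"])
        (simp add: generators_def quo_mult mult_single m del: One_nat_def)
  qed
qed

lemma generators_span:
  "VectorSpace.subspace K (quot.span generators) A"
  "vectorspace.fin_dim K (A\<lparr>carrier := quot.span generators\<rparr>)"
  "generators \<subseteq> quot.span generators" "quot.span generators \<subseteq> carrier A"
proof -
  show "VectorSpace.subspace K (quot.span generators) A"
    using generators(2) by (rule quot.span_is_subspace)
  then show "vectorspace.fin_dim K (A\<lparr>carrier := quot.span generators\<rparr>)"
    using generators by (rule quot.subspace_dim_le_card(1)) simp
  show "generators \<subseteq> quot.span generators" using generators(2) by (rule quot.in_own_span)
  show "quot.span generators \<subseteq> carrier A" using generators(2) by (rule quot.span_is_subset2)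
qed

text \<open>Thanks to the padding the coset already lies in the top summand, of exponent
  \<open>n\<close>. For \<open>n = 0\<close> the sum is the zero subspace, so \<open>n\<close> must
  be positive.\<close>

lemma quo_mono_in_subspace_pow_upto:
  assumes "(\<Sum>x\<in>UNIV. Poly_Mapping.lookup m x) \<le> n" "0 < n"
  shows "quo (mono_poly m) \<in> subspace_pow_upto K A (quot.span generators) n"
proof -
  let ?V = "quot.span generators"
  obtain k where n: "n = Suc k" using assms(2) by (cases n) auto
  have "quo (mono_poly m) \<in> nfold_products A ?V n"
    using quo_mono_eq_product[OF assms(1)] generators_span(3) unfolding nfold_products_def by blast
  then have "quo (mono_poly m) \<in> subspace_pow K A ?V n"
    using quot.in_own_span[OF nfold_products_closed[OF generators_span(4)]]
    unfolding subspace_pow_def by blast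
  moreover have "\<zero>\<^bsub>A\<^esub> \<in> subspace_pow_upto K A ?V k"
    using subspace_pow_upto_subspace[OF generators_span(4)] submodule.zero_closed quot.is_module by blast
  ultimately have "\<zero>\<^bsub>A\<^esub> \<oplus>\<^bsub>A\<^esub> quo (mono_poly m) \<in> subspace_pow_upto K A ?V n"
    unfolding n by (auto simp: set_add_def')
  then show ?thesis by (simp add: quo_closed)
qed

lemma fin_dim_subspace_pow_upto:
  "vectorspace.fin_dim K (A\<lparr>carrier := subspace_pow_upto K A (quot.span generators) n\<rparr>)"
proof -
  obtain N where "generators \<subseteq> filtration N"
    using finite_subset_filtration[OF generators] by blast
  then have "quot.span generators \<subseteq> filtration N"
    using filtration_submodule by (rule quot.span_is_subset)
  then show ?thesis
    using subspace_pow_upto_subspace[OF generators_span(4)] subspace_pow_upto_filtration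
    by (intro dim_subspace_filtration_le(1))
qed

text \<open>A corner attaining \<open>corner_deg\<close> has that many large directions. The
  monomials supported there are all irreducible, and a full box of them has independent
  cosets.\<close>

lemma dim_subspace_pow_upto_ge:
  assumes "corner_Irr \<noteq> {}" "0 < n"
  shows "(n div card (UNIV :: 'x set) + 1) ^ corner_deg \<le>
    vectorspace.dim K (A\<lparr>carrier := subspace_pow_upto K A (quot.span generators) n\<rparr>)"
proof -
  let ?W = "subspace_pow_upto K A (quot.span generators) n"
  let ?p = "card (UNIV :: 'x set)"
  let ?q = "\<lambda>m. quo (mono_poly m)"
  have "corner_deg \<in> Sdeg_mono r S ` corner_Irr"
    using assms(1) finite_Sdeg_mono_image Max_in by (simp add: corner_deg_def Sdeg_def)
  then obtain u where u: "u \<in> corner_Irr" "corner_deg = Sdeg_mono r S u" by blast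
  define D where "D = {x. C_bound r S < Poly_Mapping.lookup u x}"
  \<comment> \<open>With side \<open>n div ?p\<close> in each of at most \<open>?p\<close>
    directions the total degree does not exceed \<open>n\<close>.\<close>
  define M where "M = {m :: 'x monomial. \<forall>x. Poly_Mapping.lookup m x \<in> (if x \<in> D then {..n div ?p} else {0})}"
  have M: "finite M"
    unfolding M_def by (rule card_poly_mapping_box(1)) simp
  have "card M = (\<Prod>x\<in>UNIV. if x \<in> D then n div ?p + 1 else 1)"
    unfolding M_def by (subst card_poly_mapping_box(2)) (auto intro: prod.cong)
  also have "\<dots> = (n div ?p + 1) ^ corner_deg"
    by (simp add: prod.If_cases u(2) Sdeg_mono_def D_def)
  finally have card: "card M = (n div ?p + 1) ^ corner_deg" .
  have Irr: "M \<subseteq> Irr r S"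
  proof
    fix m assume m: "m \<in> M"
    have "Poly_Mapping.lookup m x = 0" if "Poly_Mapping.lookup u x \<le> C_bound r S" for x
    proof -
      have "x \<notin> D" using that by (simp add: D_def)
      then show ?thesis using m by (auto simp: M_def dest: spec[of _ x])
    qed
    moreover have "u \<in> Irr r S" using u(1) by (simp add: corner_Irr_def)
    ultimately show "m \<in> Irr r S" by (rule Irr_if_support_large[rotated])
  qed
  have W: "?q ` M \<subseteq> ?W"
  proof clarify
    fix m assume "m \<in> M"
    then have "Poly_Mapping.lookup m x \<le> n div ?p" for x
      by (auto simp: M_def dest!: spec[of _ x] split: if_splits)
    then have "(\<Sum>x\<in>UNIV. Poly_Mapping.lookup m x) \<le> ?p * (n div ?p)"
      using sum_bounded_above[of UNIV "Poly_Mapping.lookup m" "n div ?p"] by simp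
    also have "\<dots> \<le> n" by simp
    finally show "?q m \<in> ?W" using assms(2) by (rule quo_mono_in_subspace_pow_upto)
  qed
  have "card M = card (?q ` M)"
    using inj_on_subset[OF inj_on_quo_mono Irr] by (simp add: card_image)
  also have "\<dots> \<le> vectorspace.dim K (A\<lparr>carrier := ?W\<rparr>)"
    by (rule quot.card_le_subspace_dim[OF subspace_pow_upto_subspace[OF generators_span(4)]
        fin_dim_subspace_pow_upto W lin_indpt_Irr[OF M Irr]])
  finally show ?thesis by (simp add: card)
qed

lemma limsup_dim_ge:
  "ereal (real corner_deg) \<le> limsup (\<lambda>n. ereal (log (real n)
     (real (vectorspace.dim K (A\<lparr>carrier := subspace_pow_upto K A (quot.span generators) n\<rparr>)))))"
  (is "_ \<le> limsup (\<lambda>n. ereal (log (real n) (real (?dim n))))")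
proof (cases "corner_Irr = {}")
  case True
  \<comment> \<open>Without corners the claimed degree is 0, and nonnegativity suffices. It holds at
    dimension 0 too, as \<open>log\<close> of 0 is 0.\<close>
  have "0 \<le> ereal (log (real n) (real (?dim n)))" if "1 < n" for n
    using that by (cases "?dim n = 0") (simp_all add: log_def)
  then have "0 \<le> limsup (\<lambda>n. ereal (log (real n) (real (?dim n))))"
    by (intro le_Limsup eventually_mono[OF eventually_gt_at_top[of 1]]) auto
  then show ?thesis using True by (simp add: corner_deg_def Sdeg_def flip: zero_ereal_def)
next
  case False
  define p where "p = card (UNIV :: 'x set)"
  have p: "0 < p" by (simp add: p_def card_gt_0_iff)
  \<comment> \<open>The box has at least \<open>(n / p) ^ corner_deg\<close> points;
    \<open>c\<close> is what remains after \<open>n ^ corner_deg\<close> is split off.\<close>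
  define c where "c = (1 / real p) ^ corner_deg"
  have c: "0 < c" using p by (simp add: c_def)
  have "\<forall>\<^sub>F n in sequentially. ereal (log (real n) (c * real n ^ corner_deg)) \<le> ereal (log (real n) (real (?dim n)))"
    using eventually_gt_at_top[of 1]
  proof eventually_elim
    case (elim n)
    have "n \<le> (n div p + 1) * p"
      using dividend_less_times_div[OF p, of n] by (simp add: algebra_simps)
    then have "real n \<le> real (n div p + 1) * real p"
      by (simp only: of_nat_mult[symmetric] of_nat_le_iff)
    then have "real n / real p \<le> real (n div p + 1)"
      using p by (simp add: divide_le_eq)
    then have "(real n / real p) ^ corner_deg \<le> real (n div p + 1) ^ corner_deg"
      by (intro power_mono) auto
    also have "\<dots> \<le> real (?dim n)"
      using dim_subspace_pow_upto_ge[OF False, of n] elim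
      by (simp only: p_def of_nat_power[symmetric] of_nat_le_iff)
    finally have "c * real n ^ corner_deg \<le> real (?dim n)"
      by (simp add: c_def power_divide)
    moreover have "0 < c * real n ^ corner_deg" using c elim by simp
    ultimately show ?case using elim by (simp add: log_mono)
  qed
  then have "limsup (\<lambda>n. ereal (log (real n) (c * real n ^ corner_deg))) \<le> limsup (\<lambda>n. ereal (log (real n) (real (?dim n))))"
    by (rule Limsup_mono)
  moreover have "limsup (\<lambda>n. ereal (log (real n) (c * real n ^ corner_deg))) = ereal (real corner_deg)"
    using tendsto_log_const_mult_power[OF c, of corner_deg] by (intro lim_imp_Limsup) auto
  ultimately show ?thesis by simp
qed

text \<open>In the zero algebra no monomial is irreducible, so the conventions for
  \<open>Sdeg\<close> of the empty set and for the dimension of the zero algebra agree.\<close>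

lemma corner_deg_eq_0_if_trivial:
  assumes "carrier A = {\<zero>\<^bsub>A\<^esub>}"
  shows "corner_deg = 0"
proof -
  have "u \<notin> Irr r S" for u
  proof
    assume u: "u \<in> Irr r S"
    have "quo (mono_poly u) = quo 0" using assms quo_closed by (auto simp: quo_zero)
    then have "mono_poly u \<in> Id_gen S" by (simp add: quo_eq_iff)
    then have "mono_poly u = (0 :: ('x, 'k) mpoly)" using u by (intro ideal_Irr_eq_0) auto
    then show False by (metis lookup_single_eq lookup_zero zero_neq_one)
  qed
  then show ?thesis by (simp add: corner_deg_def corner_Irr_def Sdeg_def)
qed

text \<open>The upper bound holds for every finite-dimensional \<open>V\<close>, and the span of
  \<open>generators\<close> attains it.\<close>

lemma gk_dim_quot: "gk_dim K A = ereal (real corner_deg)"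
proof (cases "carrier A = {\<zero>\<^bsub>A\<^esub>}")
  case True
  then show ?thesis by (simp add: gk_dim_def corner_deg_eq_0_if_trivial)
next
  case False
  show ?thesis
    unfolding gk_dim_def if_not_P[OF False]
  proof (rule antisym)
    show "(SUP V \<in> {V. VectorSpace.subspace K V A \<and> vectorspace.fin_dim K (A\<lparr>carrier := V\<rparr>)}.
        limsup (\<lambda>n. ereal (log (real n)
          (real (vectorspace.dim K (A\<lparr>carrier := subspace_pow_upto K A V n\<rparr>)))))) \<le> ereal (real corner_deg)"
      by (rule SUP_least) (auto intro: limsup_dim_le)
  qed (rule SUP_upper2[where i = "quot.span generators"], simp add: generators_span, rule limsup_dim_ge)
qed

end

theorem theorem2p3:
  fixes r :: "('x::finite) monomial rel"
    and S :: "('x, 'k::field) mpoly set"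
  assumes "monomial_order r"
    and "finite S"
    and "groebner_basis r (Id_gen S) S"
  shows "gk_dim (class_ring :: 'k ring) (quot_algebra (Id_gen S)) =
    ereal (real (Sdeg r S
      {u \<in> Irr r S. \<forall>i. Poly_Mapping.lookup u i \<in> {0, C_bound r S + 1}}))"
proof -
  interpret groebner r S by unfold_locales (use assms in auto)
  obtain w :: "'x \<Rightarrow> real" where w: "\<And>x. 1 \<le> w x"
    "\<And>s m. s \<in> S \<Longrightarrow> m \<in> Poly_Mapping.keys s \<Longrightarrow> (\<Sum>x\<in>UNIV. w x * real (Poly_Mapping.lookup m x)) \<le>
      (\<Sum>x\<in>UNIV. w x * real (Poly_Mapping.lookup (lead_mono r s) x))"
    using weights_exist by auto
  interpret weighted_groebner r S w by unfold_locales (use w in auto)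
  show ?thesis using gk_dim_quot by (simp only: corner_deg_def corner_Irr_def)
qed

end
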